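(* Let $A=\ell^1(\mathbb{Z}^+)$ with convolution product, and let $D:A\to A^*$ be a bounded derivation. Then $D$ is compact if and only if $(D(t^n)(1))_{n\in\mathbb{N}}\in c_0$.
   Context: All Banach spaces are over $\mathbb{C}$; $\mathbb{Z}^+=\{0,1,2,\dots\}$ and $\mathbb{N}=\{1,2,\dots\}$. $A=\ell^1(\mathbb{Z}^+)$ is the commutative Banach algebra of absolutely summable complex sequences $a=(a_n)_{n\in\mathbb{Z}^+}$ with the $\ell^1$ norm and product $ab=\left(\sum_{r=0}^n a_r b_{n-r}\right)_{n\in\mathbb{Z}^+}$. The finitely supported sequences are identified with the polynomial algebra $\mathbb{C}[t]$, so that $t=(0,1,0,0,\dots)$, $t^n$ is the sequence with $1$ in position $n$ and $0$ elsewhere, and $1=t^0=(1,0,0,\dots)$ is the identity. The dual $A^*$ is an $A$-bimodule with actions $(a\cdot\psi)(x)=\psi(xa)$ and $(\psi\cdot a)(x)=\psi(ax)$ for $a,x\in A$, $\psi\in A^*$. A derivation $D:A\to A^*$ is a linear map with $D(ab)=a\cdot D(b)+D(a)\cdot b$ for all $a,b\in A$. $D$ is compact if the image of the closed unit ball of $A$ has compact norm closure in $A^*$. $c_0$ denotes the space of complex sequences indexed by $\mathbb{N}$ converging to $0$. *)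

theory Defs
  imports "HOL-Analysis.Analysis"
begin

typedef ell1 = "{a :: nat \<Rightarrow> complex. summable (\<lambda>n. norm (a n))}"
  morphisms nth_ell1 Abs_ell1
  by (rule exI[of _ "\<lambda>_. 0"]) simp

setup_lifting type_definition_ell1

lemma summable_nth_ell1: "summable (\<lambda>n. norm (nth_ell1 a n))"
  using nth_ell1[of a] by simp

lemma ell1_eqI: "(\<And>n. nth_ell1 a n = nth_ell1 b n) \<Longrightarrow> a = b"
  by (metis ext nth_ell1_inject)

lemma summable_norm_convolution:
  fixes a b :: "nat \<Rightarrow> complex"
  assumes "summable (\<lambda>n. norm (a n))" "summable (\<lambda>n. norm (b n))"
  shows "summable (\<lambda>n. norm (\<Sum>r\<le>n. a r * b (n - r)))"
    and "(\<Sum>n. norm (\<Sum>r\<le>n. a r * b (n - r))) \<le> (\<Sum>n. norm (a n)) * (\<Sum>n. norm (b n))"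
proof -
  have le: "norm (\<Sum>r\<le>n. a r * b (n - r)) \<le> (\<Sum>r\<le>n. norm (a r) * norm (b (n - r)))" for n
    by (rule order_trans[OF norm_sum]) (simp add: norm_mult)
  have s: "(\<lambda>n. \<Sum>r\<le>n. norm (a r) * norm (b (n - r))) sums
      ((\<Sum>n. norm (a n)) * (\<Sum>n. norm (b n)))"
    by (rule Cauchy_product_sums) (simp_all add: assms)
  show c: "summable (\<lambda>n. norm (\<Sum>r\<le>n. a r * b (n - r)))"
    by (rule summable_comparison_test'[OF sums_summable[OF s], of 0]) (simp add: le)
  show "(\<Sum>n. norm (\<Sum>r\<le>n. a r * b (n - r))) \<le> (\<Sum>n. norm (a n)) * (\<Sum>n. norm (b n))"
    using suminf_le[OF le c sums_summable[OF s]] sums_unique[OF s] by simp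
qed

instantiation ell1 :: comm_ring_1
begin

lift_definition zero_ell1 :: ell1 is "\<lambda>_. 0" by simp

lift_definition one_ell1 :: ell1 is "\<lambda>n. if n = 0 then 1 else 0"
  by (rule summable_finite[of "{0}"]) auto

lift_definition plus_ell1 :: "ell1 \<Rightarrow> ell1 \<Rightarrow> ell1" is "\<lambda>a b n. a n + b n"
proof -
  fix a b :: "nat \<Rightarrow> complex"
  assume s: "summable (\<lambda>n. norm (a n))" "summable (\<lambda>n. norm (b n))"
  show "summable (\<lambda>n. norm (a n + b n))"
    by (rule summable_comparison_test'[OF summable_add[OF s], of 0])
       (auto intro: norm_triangle_ineq)
qed

lift_definition uminus_ell1 :: "ell1 \<Rightarrow> ell1" is "\<lambda>a n. - a n" by simp

lift_definition minus_ell1 :: "ell1 \<Rightarrow> ell1 \<Rightarrow> ell1" is "\<lambda>a b n. a n - b n"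
proof -
  fix a b :: "nat \<Rightarrow> complex"
  assume s: "summable (\<lambda>n. norm (a n))" "summable (\<lambda>n. norm (b n))"
  show "summable (\<lambda>n. norm (a n - b n))"
    by (rule summable_comparison_test'[OF summable_add[OF s], of 0])
       (auto intro: norm_triangle_ineq4)
qed

lift_definition times_ell1 :: "ell1 \<Rightarrow> ell1 \<Rightarrow> ell1"
  is "\<lambda>a b n. \<Sum>r\<le>n. a r * b (n - r)"
  by (rule summable_norm_convolution)

instance
proof
  have fps: "fps_nth (Abs_fps (nth_ell1 a) * Abs_fps (nth_ell1 b)) n = nth_ell1 (a * b) n" for a b n
    by (simp add: fps_mult_nth times_ell1.rep_eq atLeast0AtMost)
  hence fps': "Abs_fps (nth_ell1 (a * b)) = Abs_fps (nth_ell1 a) * Abs_fps (nth_ell1 b)" for a b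
    by (simp add: fps_eq_iff)
  have fps1: "Abs_fps (nth_ell1 1) = 1"
    by (simp add: fps_eq_iff one_ell1.rep_eq)
  have inj: "a = b" if "Abs_fps (nth_ell1 a) = Abs_fps (nth_ell1 b)" for a b
    using that by (intro ell1_eqI) (simp add: fps_eq_iff)
  fix a b c :: ell1
  show "a * b * c = a * (b * c)" by (rule inj) (simp add: fps' mult.assoc)
  show "a * b = b * a" by (rule inj) (simp add: fps' mult.commute)
  show "1 * a = a" by (rule inj) (simp add: fps' fps1)
  show "a + b + c = a + (b + c)" by transfer (simp add: add.assoc)
  show "a + b = b + a" by transfer (simp add: add.commute)
  show "0 + a = a" by transfer simp
  show "- a + a = 0" by transfer simp
  show "a - b = a + - b" by transfer simp
  show "(a + b) * c = a * c + b * c"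
    by transfer (simp add: distrib_right sum.distrib)
  have "nth_ell1 0 0 \<noteq> nth_ell1 1 0" by (simp add: zero_ell1.rep_eq one_ell1.rep_eq)
  thus "(0::ell1) \<noteq> 1" by metis
qed

end

lift_definition scaleC_ell1 :: "complex \<Rightarrow> ell1 \<Rightarrow> ell1"  (infixr \<open>*\<^sub>C\<close> 75)
  is "\<lambda>c a n. c * a n"
  by (simp add: norm_mult summable_mult)

instantiation ell1 :: real_normed_algebra_1
begin

definition scaleR_ell1 :: "real \<Rightarrow> ell1 \<Rightarrow> ell1"
  where "scaleR_ell1 r a = complex_of_real r *\<^sub>C a"

lift_definition norm_ell1 :: "ell1 \<Rightarrow> real" is "\<lambda>a. \<Sum>n. norm (a n)" .

definition dist_ell1 :: "ell1 \<Rightarrow> ell1 \<Rightarrow> real"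
  where "dist_ell1 a b = norm (a - b)"

definition sgn_ell1 :: "ell1 \<Rightarrow> ell1"
  where "sgn_ell1 a = inverse (norm a) *\<^sub>R a"

definition uniformity_ell1 :: "(ell1 \<times> ell1) filter"
  where "uniformity_ell1 = (INF e\<in>{0<..}. principal {(a, b). dist a b < e})"

definition open_ell1 :: "ell1 set \<Rightarrow> bool"
  where "open_ell1 U = (\<forall>a\<in>U. \<forall>\<^sub>F (a', b) in uniformity. a' = a \<longrightarrow> b \<in> U)"

instance
proof
  fix a b c :: ell1 and r s :: real
  show "dist a b = norm (a - b)" by (rule dist_ell1_def)
  show "sgn a = inverse (norm a) *\<^sub>R a" by (rule sgn_ell1_def)
  show "(uniformity :: (ell1 \<times> ell1) filter) = (INF e\<in>{0<..}. principal {(a, b). dist a b < e})"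
    by (rule uniformity_ell1_def)
  show "open U = (\<forall>a\<in>U. \<forall>\<^sub>F (a', b) in uniformity. a' = a \<longrightarrow> b \<in> U)" for U :: "ell1 set"
    by (rule open_ell1_def)
  show "r *\<^sub>R (a + b) = r *\<^sub>R a + r *\<^sub>R b"
    unfolding scaleR_ell1_def by transfer (simp add: algebra_simps)
  show "(r + s) *\<^sub>R a = r *\<^sub>R a + s *\<^sub>R a"
    unfolding scaleR_ell1_def by transfer (simp add: algebra_simps)
  show "r *\<^sub>R s *\<^sub>R a = (r * s) *\<^sub>R a"
    unfolding scaleR_ell1_def by transfer (simp add: algebra_simps)
  show "1 *\<^sub>R a = a"
    unfolding scaleR_ell1_def by transfer simp
  show "r *\<^sub>R a * b = r *\<^sub>R (a * b)"
    unfolding scaleR_ell1_def by transfer (simp add: sum_distrib_left algebra_simps)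
  show "a * r *\<^sub>R b = r *\<^sub>R (a * b)"
    unfolding scaleR_ell1_def by transfer (simp add: sum_distrib_left algebra_simps)
  show "norm a = 0 \<longleftrightarrow> a = 0"
    by transfer (auto simp: suminf_eq_zero_iff)
  show "norm (a + b) \<le> norm a + norm b"
  proof transfer
    fix a b :: "nat \<Rightarrow> complex"
    assume s: "summable (\<lambda>n. norm (a n))" "summable (\<lambda>n. norm (b n))"
    have "summable (\<lambda>n. norm (a n + b n))"
      by (rule summable_comparison_test'[OF summable_add[OF s], of 0])
         (auto intro: norm_triangle_ineq)
    thus "(\<Sum>n. norm (a n + b n)) \<le> (\<Sum>n. norm (a n)) + (\<Sum>n. norm (b n))"
      by (subst suminf_add[OF s]) (intro suminf_le norm_triangle_ineq summable_add s)
  qed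
  show "norm (r *\<^sub>R a) = \<bar>r\<bar> * norm a"
    unfolding scaleR_ell1_def by transfer (simp add: norm_mult suminf_mult)
  show "norm (a * b) \<le> norm a * norm b"
    by transfer (rule summable_norm_convolution)
  show "norm (1 :: ell1) = 1"
    by transfer (subst suminf_finite[of "{0}"]; simp)
qed

end

lemma nth_ell1_add: "nth_ell1 (a + b) n = nth_ell1 a n + nth_ell1 b n"
  and nth_ell1_diff: "nth_ell1 (a - b) n = nth_ell1 a n - nth_ell1 b n"
  and nth_ell1_scaleC: "nth_ell1 (c *\<^sub>C a) n = c * nth_ell1 a n"
  by (simp_all add: plus_ell1.rep_eq minus_ell1.rep_eq scaleC_ell1.rep_eq)

lemma scaleC_ell1_mult_left: "c *\<^sub>C a * b = c *\<^sub>C (a * b)"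
  and scaleC_ell1_mult_right: "a * c *\<^sub>C b = c *\<^sub>C (a * b)"
  by (transfer; simp add: sum_distrib_left algebra_simps)+

lemma norm_scaleC_ell1: "norm (c *\<^sub>C a) = norm c * norm a"
  by transfer (simp add: norm_mult suminf_mult)

lemma sum_norm_nth_le_norm: "(\<Sum>n<N. norm (nth_ell1 a n)) \<le> norm a"
  unfolding norm_ell1.rep_eq by (rule sum_le_suminf[OF summable_nth_ell1]) auto

lemma norm_nth_le_norm: "norm (nth_ell1 a n) \<le> norm a"
proof -
  have "norm (nth_ell1 a n) \<le> (\<Sum>k<Suc n. norm (nth_ell1 a k))"
    by (rule member_le_sum) auto
  also have "\<dots> \<le> norm a" by (rule sum_norm_nth_le_norm)
  finally show ?thesis .
qed

instance ell1 :: banach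
proof
  fix X :: "nat \<Rightarrow> ell1"
  assume X: "Cauchy X"
  have "Cauchy (\<lambda>k. nth_ell1 (X k) n)" for n
  proof (rule metric_CauchyI)
    fix e :: real assume "e > 0"
    then obtain M where "\<forall>m\<ge>M. \<forall>k\<ge>M. dist (X m) (X k) < e"
      using X by (meson metric_CauchyD)
    thus "\<exists>M. \<forall>m\<ge>M. \<forall>k\<ge>M. dist (nth_ell1 (X m) n) (nth_ell1 (X k) n) < e"
      by (metis dist_norm nth_ell1_diff norm_nth_le_norm order_le_less_trans)
  qed
  hence "\<exists>l. (\<lambda>k. nth_ell1 (X k) n) \<longlonglongrightarrow> l" for n
    by (simp add: Cauchy_convergent_iff convergent_def)
  then obtain l where l: "\<And>n. (\<lambda>k. nth_ell1 (X k) n) \<longlonglongrightarrow> l n" by metis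
  have bound: "\<exists>M. \<forall>m\<ge>M. \<forall>N. (\<Sum>n<N. norm (nth_ell1 (X m) n - l n)) \<le> e" if "e > 0" for e
  proof -
    obtain M where M: "\<forall>m\<ge>M. \<forall>k\<ge>M. dist (X m) (X k) < e"
      using X \<open>e > 0\<close> by (meson metric_CauchyD)
    have "(\<Sum>n<N. norm (nth_ell1 (X m) n - l n)) \<le> e" if "m \<ge> M" for m N
    proof (rule LIMSEQ_le_const2)
      show "(\<lambda>k. \<Sum>n<N. norm (nth_ell1 (X m) n - nth_ell1 (X k) n))
          \<longlonglongrightarrow> (\<Sum>n<N. norm (nth_ell1 (X m) n - l n))"
        by (intro tendsto_intros l)
      have "(\<Sum>n<N. norm (nth_ell1 (X m) n - nth_ell1 (X k) n)) \<le> e" if "k \<ge> M" for k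
        using sum_norm_nth_le_norm[where N = N and a = "X m - X k"] M \<open>m \<ge> M\<close> that
        by (fastforce simp: nth_ell1_diff dist_norm)
      thus "\<exists>K. \<forall>k\<ge>K. (\<Sum>n<N. norm (nth_ell1 (X m) n - nth_ell1 (X k) n)) \<le> e" by blast
    qed
    thus ?thesis by blast
  qed
  obtain M where M: "\<And>N. (\<Sum>n<N. norm (nth_ell1 (X M) n - l n)) \<le> 1"
    using bound[of 1] by auto
  have "summable (\<lambda>n. norm (nth_ell1 (X M) n - l n))"
    by (rule summableI_nonneg_bounded[of _ 1]) (use M in auto)
  hence "summable (\<lambda>n. norm (nth_ell1 (X M) n) + norm (nth_ell1 (X M) n - l n))"
    by (intro summable_add summable_nth_ell1)
  hence suml: "summable (\<lambda>n. norm (l n))"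
    by (rule summable_comparison_test'[of _ 0])
       (metis norm_minus_commute norm_triangle_sub real_norm_def abs_norm_cancel)
  define L where "L = Abs_ell1 l"
  have L: "nth_ell1 L = l" unfolding L_def by (rule Abs_ell1_inverse) (simp add: suml)
  have "X \<longlonglongrightarrow> L"
  proof (rule metric_LIMSEQ_I)
    fix e :: real assume "e > 0"
    then obtain M where M: "\<forall>m\<ge>M. \<forall>N. (\<Sum>n<N. norm (nth_ell1 (X m) n - l n)) \<le> e / 2"
      using bound[of "e / 2"] by auto
    have "dist (X m) L < e" if "m \<ge> M" for m
    proof -
      have "norm (X m - L) \<le> e / 2"
        unfolding norm_ell1.rep_eq
        by (rule suminf_le_const[OF summable_nth_ell1])
           (use M that in \<open>simp add: nth_ell1_diff L\<close>)
      thus ?thesis using \<open>e > 0\<close> by (simp add: dist_norm)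
    qed
    thus "\<exists>M. \<forall>m\<ge>M. dist (X m) L < e" by blast
  qed
  thus "convergent X" by (auto simp: convergent_def)
qed

lift_definition t_ell1 :: ell1 is "\<lambda>n. if n = 1 then 1 else 0"
  by (rule summable_finite[of "{1}"]) auto

lemma nth_t_ell1_power: "nth_ell1 (t_ell1 ^ m) n = (if n = m then 1 else 0)"
proof (induction m arbitrary: n)
  case 0
  show ?case by (simp add: one_ell1.rep_eq)
next
  case (Suc m)
  have "nth_ell1 (t_ell1 ^ Suc m) n = (\<Sum>r\<le>n. if r = 1 then (if n - 1 = m then 1 else 0) else 0)"
    unfolding power_Suc times_ell1.rep_eq
    by (intro sum.cong) (simp_all add: t_ell1.rep_eq Suc.IH)
  also have "\<dots> = (if n = Suc m then 1 else 0)"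
    by (cases n) simp_all
  finally show ?case .
qed


text \<open>
  Bounded linear functions are only real-linear in the library, so the dual consists of
  those bounded functionals that are complex-linear. It carries the operator norm
  inherited from \<^typ>\<open>ell1 \<Rightarrow>\<^sub>L complex\<close> and is closed in that space (shown below), so closures
  of subsets of the dual may be taken in the ambient space.
\<close>

definition dual_ell1 :: "(ell1 \<Rightarrow>\<^sub>L complex) set"
  where "dual_ell1 = {\<psi>. \<forall>c a. blinfun_apply \<psi> (c *\<^sub>C a) = c * blinfun_apply \<psi> a}"

lemma closed_dual_ell1: "closed dual_ell1"
proof -
  have eq: "dual_ell1 = (\<Inter>c. \<Inter>a. {\<psi>. blinfun_apply \<psi> (c *\<^sub>C a) = c * blinfun_apply \<psi> a})"
    by (auto simp: dual_ell1_def)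
  have "closed {\<psi>. blinfun_apply \<psi> (c *\<^sub>C a) = c * blinfun_apply \<psi> a}" for c a
    by (intro closed_Collect_eq continuous_on_mult blinfun.continuous_on
        continuous_on_id continuous_on_const)
  thus ?thesis unfolding eq by (intro closed_INT ballI)
qed

definition scaleC_dual :: "complex \<Rightarrow> (ell1 \<Rightarrow>\<^sub>L complex) \<Rightarrow> (ell1 \<Rightarrow>\<^sub>L complex)"
  where "scaleC_dual c \<psi> = Blinfun (\<lambda>x. c * blinfun_apply \<psi> x)"

definition left_act :: "ell1 \<Rightarrow> (ell1 \<Rightarrow>\<^sub>L complex) \<Rightarrow> (ell1 \<Rightarrow>\<^sub>L complex)"
  where "left_act a \<psi> = Blinfun (\<lambda>x. blinfun_apply \<psi> (x * a))"

definition right_act :: "(ell1 \<Rightarrow>\<^sub>L complex) \<Rightarrow> ell1 \<Rightarrow> (ell1 \<Rightarrow>\<^sub>L complex)"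
  where "right_act \<psi> a = Blinfun (\<lambda>x. blinfun_apply \<psi> (a * x))"

lemma scaleC_dual_apply: "blinfun_apply (scaleC_dual c \<psi>) x = c * blinfun_apply \<psi> x"
  and left_act_apply: "blinfun_apply (left_act a \<psi>) x = blinfun_apply \<psi> (x * a)"
  and right_act_apply: "blinfun_apply (right_act \<psi> a) x = blinfun_apply \<psi> (a * x)"
  unfolding scaleC_dual_def left_act_def right_act_def
  by (subst bounded_linear_Blinfun_apply,
      intro bounded_linear_const_mult blinfun.bounded_linear_right
        bounded_linear_compose[OF blinfun.bounded_linear_right bounded_linear_mult_left]
        bounded_linear_compose[OF blinfun.bounded_linear_right bounded_linear_mult_right],
      rule refl)+

lemma left_act_in_dual: "\<psi> \<in> dual_ell1 \<Longrightarrow> left_act a \<psi> \<in> dual_ell1"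
  and right_act_in_dual: "\<psi> \<in> dual_ell1 \<Longrightarrow> right_act \<psi> a \<in> dual_ell1"
  by (simp_all add: dual_ell1_def left_act_apply right_act_apply
      scaleC_ell1_mult_left scaleC_ell1_mult_right)

definition derivation :: "(ell1 \<Rightarrow> (ell1 \<Rightarrow>\<^sub>L complex)) \<Rightarrow> bool"
  where "derivation D \<longleftrightarrow>
    (\<forall>a. D a \<in> dual_ell1) \<and>
    (\<forall>a b. D (a + b) = D a + D b) \<and>
    (\<forall>c a. D (c *\<^sub>C a) = scaleC_dual c (D a)) \<and>
    (\<forall>a b. D (a * b) = left_act a (D b) + right_act (D a) b)"

definition compact_map :: "('a::real_normed_vector \<Rightarrow> 'b::real_normed_vector) \<Rightarrow> bool"
  where "compact_map T \<longleftrightarrow> compact (closure (T ` cball 0 1))"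

text \<open>Sequences indexed by 1, 2, 3 etc. are written with the index shifted by \<open>Suc\<close>.\<close>

definition c0 :: "(nat \<Rightarrow> complex) set"
  where "c0 = {x. x \<longlonglongrightarrow> 0}"

end

theory Submission
  imports Defs
begin

text \<open>
  Write \<open>c\<^sub>n = D(t\<^sup>n)(1)\<close>. Iterating the Leibniz rule gives \<open>D(t\<^sup>n) = n t\<^sup>n\<^sup>-\<^sup>1 \<cdot> D(t)\<close> for \<open>n \<ge> 1\<close>, so
  \<open>D(t\<^sup>n)(t\<^sup>m)\<close> and \<open>c\<^sub>n\<^sub>+\<^sub>m\<close> are both multiples of the single number \<open>D(t)(t\<^sup>n\<^sup>+\<^sup>m\<^sup>-\<^sup>1)\<close>; comparing them,

    \<open>(n + m) D(t\<^sup>n)(t\<^sup>m) = n c\<^sub>n\<^sub>+\<^sub>m\<close>   (lemma \<open>derivation_power_power\<close>).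

  Both directions are read off from this identity.

  If \<open>c\<close> tends to 0, then the factor \<open>n/(n+m)\<close> being at most 1, all coordinates of \<open>D(t\<^sup>n)\<close> are
  bounded by the supremum of \<open>|c\<^sub>k|\<close> over \<open>k \<ge> n\<close>. As the norm of a functional on \<open>\<ell>\<^sup>1\<close> is the
  supremum of its coordinates, \<open>D(t\<^sup>n)\<close> tends to 0 in norm. Hence \<open>D\<close> is, in operator norm, the
  limit of the finite-rank maps obtained by truncating the argument, and so is compact
  (lemmas \<open>derivation_power_tendsto_0\<close> and \<open>compact_map_if_null_on_powers\<close>).

  Conversely, \<open>c\<close> is bounded, so for fixed \<open>n\<close> the factor \<open>n/(n+m)\<close> forces \<open>D(t\<^sup>n)(t\<^sup>m) \<longrightarrow> 0\<close> as
  \<open>m\<close> grows. If \<open>D\<close> is compact, the functionals \<open>D(t\<^sup>n)\<close> form a relatively compact set, and on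
  such a set this convergence is uniform in \<open>n\<close> (lemma \<open>uniformly_null_if_relatively_compact\<close>).
  Splitting \<open>n = k + m\<close> with \<open>m \<le> k\<close> about equal, \<open>|c\<^sub>n|\<close> is at most \<open>2 |D(t\<^sup>k)(t\<^sup>m)|\<close>, which is
  small because \<open>m\<close> is large, whatever \<open>k\<close> is.
\<close>

section \<open>Monomial expansions\<close>

lemma norm_t_ell1_power: "norm (t_ell1 ^ m) = 1"
  unfolding norm_ell1.rep_eq
  by (subst suminf_finite[of "{m}"]) (auto simp: nth_t_ell1_power)

lemma nth_ell1_sum: "nth_ell1 (sum f I) n = (\<Sum>i\<in>I. nth_ell1 (f i) n)"
  by (induction I rule: infinite_finite_induct) (simp_all add: zero_ell1.rep_eq nth_ell1_add)

definition truncate_ell1 :: "nat \<Rightarrow> ell1 \<Rightarrow> ell1"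
  where "truncate_ell1 N a = (\<Sum>n<N. nth_ell1 a n *\<^sub>C t_ell1 ^ n)"

lemma nth_truncate_ell1: "nth_ell1 (truncate_ell1 N a) n = (if n < N then nth_ell1 a n else 0)"
  by (simp add: truncate_ell1_def nth_ell1_sum nth_ell1_scaleC nth_t_ell1_power if_distrib
      cong: if_cong)

lemma norm_ell1_mono:
  assumes "\<And>n. norm (nth_ell1 a n) \<le> norm (nth_ell1 b n)"
  shows "norm a \<le> norm b"
  unfolding norm_ell1.rep_eq by (intro suminf_le assms summable_nth_ell1)

lemma norm_diff_truncate_ell1:
  "norm (a - truncate_ell1 N a) = (\<Sum>n. norm (nth_ell1 a (n + N)))"
  unfolding norm_ell1.rep_eq
  by (subst suminf_split_initial_segment[where k = N, OF summable_nth_ell1])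
     (simp add: nth_ell1_diff nth_truncate_ell1)

lemma truncate_ell1_tendsto: "(\<lambda>N. truncate_ell1 N a) \<longlonglongrightarrow> a"
proof -
  have "(\<lambda>N. norm (a - truncate_ell1 N a)) \<longlonglongrightarrow> 0"
    unfolding norm_diff_truncate_ell1 by (rule suminf_exist_split2[OF summable_nth_ell1])
  thus ?thesis
    by (subst tendsto_iff) (simp add: tendsto_iff dist_norm norm_minus_commute)
qed

text \<open>
  The universal property of the \<open>\<ell>\<^sup>1\<close> norm: an operator is bounded by its values on the monomials.
  The bound is asked only for the terms of one given \<open>a\<close>, so that for a tail
  \<open>a - truncate_ell1 N a\<close> only the monomials of degree at least \<open>N\<close> matter.
\<close>

lemma norm_le_of_norm_monomials_le:
  fixes T :: "ell1 \<Rightarrow> 'b::real_normed_vector"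
  assumes T: "bounded_linear T"
    and le: "\<And>n. norm (T (nth_ell1 a n *\<^sub>C t_ell1 ^ n)) \<le> B * norm (nth_ell1 a n)"
    and "B \<ge> 0"
  shows "norm (T a) \<le> B * norm a"
proof (rule LIMSEQ_le_const2)
  show "(\<lambda>N. norm (T (truncate_ell1 N a))) \<longlonglongrightarrow> norm (T a)"
    by (intro tendsto_norm bounded_linear.tendsto[OF T] truncate_ell1_tendsto)
  have "norm (T (truncate_ell1 N a)) \<le> B * norm a" for N
  proof -
    have "norm (T (truncate_ell1 N a)) \<le> (\<Sum>n<N. B * norm (nth_ell1 a n))"
      unfolding truncate_ell1_def linear_sum[OF bounded_linear.linear[OF T]]
      by (intro sum_norm_le le)
    also have "\<dots> = B * (\<Sum>n<N. norm (nth_ell1 a n))"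
      by (simp add: sum_distrib_left)
    also have "\<dots> \<le> B * norm a"
      by (intro mult_left_mono sum_norm_nth_le_norm \<open>B \<ge> 0\<close>)
    finally show ?thesis .
  qed
  thus "\<exists>N0. \<forall>N\<ge>N0. norm (T (truncate_ell1 N a)) \<le> B * norm a" by blast
qed

text \<open>This is the isometry of the dual with \<open>\<ell>\<^sup>\<infinity>\<close>, in the direction that needs an argument.\<close>

lemma norm_dual_le:
  assumes "\<psi> \<in> dual_ell1" and "\<And>m. norm (blinfun_apply \<psi> (t_ell1 ^ m)) \<le> B"
  shows "norm \<psi> \<le> B"
proof (rule norm_blinfun_bound)
  show "B \<ge> 0" using assms(2)[of 0] norm_ge_zero order_trans by blast
  have "norm (blinfun_apply \<psi> (c *\<^sub>C t_ell1 ^ n)) \<le> B * norm c" for c n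
    using assms mult_right_mono[OF assms(2)[of n] norm_ge_zero[of c]]
    by (simp add: dual_ell1_def norm_mult mult.commute)
  thus "norm (blinfun_apply \<psi> a) \<le> B * norm a" for a
    by (intro norm_le_of_norm_monomials_le blinfun.bounded_linear_right \<open>B \<ge> 0\<close>)
qed

lemma norm_apply_t_ell1_power_le: "norm (blinfun_apply \<psi> (t_ell1 ^ m)) \<le> norm \<psi>"
  using norm_blinfun[of \<psi> "t_ell1 ^ m"] by (simp add: norm_t_ell1_power)

section \<open>Derivations on powers\<close>

lemma derivation_one:
  assumes "derivation D"
  shows "D 1 = 0"
proof (rule blinfun_eqI)
  fix x
  have "D (1 * 1) = left_act 1 (D 1) + right_act (D 1) 1"
    using assms unfolding derivation_def by blast
  hence "blinfun_apply (D 1) x = blinfun_apply (D 1) x + blinfun_apply (D 1) x"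
    by (metis blinfun.add_left left_act_apply mult_1 mult_1_right right_act_apply)
  thus "blinfun_apply (D 1) x = blinfun_apply 0 x" by simp
qed

lemma derivation_power:
  assumes "derivation D"
  shows "blinfun_apply (D (a ^ Suc n)) x = of_nat (Suc n) * blinfun_apply (D a) (a ^ n * x)"
proof (induction n arbitrary: x)
  case 0
  show ?case by simp
next
  case (Suc n)
  have "D (a * a ^ Suc n) = left_act a (D (a ^ Suc n)) + right_act (D a) (a ^ Suc n)"
    using assms unfolding derivation_def by blast
  hence "blinfun_apply (D (a ^ Suc (Suc n))) x
      = blinfun_apply (D (a ^ Suc n)) (x * a) + blinfun_apply (D a) (a ^ Suc n * x)"
    by (simp add: blinfun.add_left left_act_apply right_act_apply)
  also have "\<dots> = of_nat (Suc (Suc n)) * blinfun_apply (D a) (a ^ Suc n * x)"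
    unfolding Suc by (simp add: algebra_simps)
  finally show ?case .
qed

text \<open>
  The key identity. By \<open>derivation_power\<close> both sides equal \<open>n (n + m) D(a)(a\<^sup>n\<^sup>+\<^sup>m\<^sup>-\<^sup>1)\<close> when \<open>n > 0\<close>.
  It is stated without division so that it covers \<open>n = m = 0\<close>.
\<close>

lemma derivation_power_power:
  assumes "derivation D"
  shows "of_nat (n + m) * blinfun_apply (D (a ^ n)) (a ^ m)
    = of_nat n * blinfun_apply (D (a ^ (n + m))) 1"
proof (cases n)
  case 0
  thus ?thesis by (simp add: derivation_one[OF assms])
next
  case (Suc k)
  have "n + m = Suc (k + m)" using Suc by simp
  thus ?thesis
    unfolding Suc derivation_power[OF assms] \<open>n + m = Suc (k + m)\<close>
    by (simp add: derivation_power[OF assms] power_add del: power_Suc)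
qed

lemma norm_derivation_power_power:
  assumes "derivation D"
  shows "real (n + m) * norm (blinfun_apply (D (a ^ n)) (a ^ m))
    = real n * norm (blinfun_apply (D (a ^ (n + m))) 1)"
  using arg_cong[OF derivation_power_power[OF assms, of n m a], of norm]
  by (simp only: norm_mult norm_of_nat)

section \<open>Compactness\<close>

text \<open>
  A set within every positive distance of some compact set is totally bounded: a finite net
  of the compact set serves as a net of the given set. This is the mechanism by which norm
  limits of finite-rank operators are compact.
\<close>

lemma compact_closure_if_totally_bounded:
  fixes S :: "'a::complete_space set"
  assumes "\<And>e. e > 0 \<Longrightarrow> \<exists>K. compact K \<and> (\<forall>x\<in>S. \<exists>y\<in>K. dist x y \<le> e)"
  shows "compact (closure S)"
  unfolding compact_eq_totally_bounded
proof (intro conjI allI impI)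
  show "complete (closure S)" by (simp add: complete_eq_closed)
  fix e :: real assume "e > 0"
  then obtain K where K: "compact K" "\<And>x. x \<in> S \<Longrightarrow> \<exists>y\<in>K. dist x y \<le> e / 4"
    using assms[of "e / 4"] by auto
  obtain F where F: "finite F" "K \<subseteq> (\<Union>y\<in>F. ball y (e / 4))"
    using K(1) \<open>e > 0\<close> unfolding compact_eq_totally_bounded by (meson divide_pos_pos zero_less_numeral)
  have "closure S \<subseteq> (\<Union>y\<in>F. ball y e)"
  proof
    fix x assume "x \<in> closure S"
    then obtain z where z: "z \<in> S" "dist z x < e / 4"
      using \<open>e > 0\<close> by (meson closure_approachable divide_pos_pos zero_less_numeral)
    obtain w where w: "w \<in> K" "dist z w \<le> e / 4" using K(2) z(1) by blast
    then obtain y where "y \<in> F" "dist y w < e / 4" using F(2) by auto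
    moreover have "dist y x \<le> dist y w + dist z w + dist z x"
      by (metis add.assoc add_left_mono dist_commute dist_triangle order_trans)
    ultimately show "x \<in> (\<Union>y\<in>F. ball y e)" using w z \<open>e > 0\<close> by force
  qed
  thus "\<exists>F. finite F \<and> closure S \<subseteq> (\<Union>y\<in>F. ball y e)" using F(1) by blast
qed

lemma norm_scaleC_dual_le: "norm (scaleC_dual c \<psi>) \<le> norm c * norm \<psi>"
  by (rule norm_blinfun_bound)
     (auto simp: scaleC_dual_apply norm_mult mult.assoc intro!: mult_left_mono norm_blinfun)

lemma bounded_linear_scaleC_dual: "bounded_linear (\<lambda>c. scaleC_dual c \<psi>)"
proof (rule bounded_linear_intro[where K = "norm \<psi>"])
  show "scaleC_dual (c + d) \<psi> = scaleC_dual c \<psi> + scaleC_dual d \<psi>" for c d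
    by (rule blinfun_eqI) (simp add: scaleC_dual_apply blinfun.add_left distrib_right)
  show "scaleC_dual (r *\<^sub>R c) \<psi> = r *\<^sub>R scaleC_dual c \<psi>" for r c
    by (rule blinfun_eqI) (simp add: scaleC_dual_apply blinfun.scaleR_left)
qed (rule norm_scaleC_dual_le)

text \<open>
  The image of a polydisc under a linear map: the compact sets that will approximate the
  image of the unit ball under a derivation.
\<close>

lemma compact_sum_scaleC_dual:
  fixes N :: nat
  shows "compact {\<Sum>n<N. scaleC_dual (c n) (f n) | c. \<forall>n<N. norm (c n) \<le> 1}"
proof (induction N)
  case 0
  show ?case by simp
next
  case (Suc N)
  have "compact ((\<lambda>c. scaleC_dual c (f N)) ` cball 0 1)"
    by (intro compact_continuous_image linear_continuous_on bounded_linear_scaleC_dual) simp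
  from compact_sums[OF Suc this] show ?case
  proof (rule back_subst[of compact], intro equalityI subsetI)
    fix x
    assume "x \<in> {x + y |x y. x \<in> {\<Sum>n<N. scaleC_dual (c n) (f n) |c. \<forall>n<N. norm (c n) \<le> 1}
        \<and> y \<in> (\<lambda>c. scaleC_dual c (f N)) ` cball 0 1}"
    then obtain c d where "x = (\<Sum>n<N. scaleC_dual (c n) (f n)) + scaleC_dual d (f N)"
      "\<forall>n<N. norm (c n) \<le> 1" "norm d \<le> 1" by auto
    thus "x \<in> {\<Sum>n<Suc N. scaleC_dual (c n) (f n) |c. \<forall>n<Suc N. norm (c n) \<le> 1}"
      by (intro CollectI exI[of _ "c(N := d)"]) (auto simp: less_Suc_eq)
  next
    fix x
    assume "x \<in> {\<Sum>n<Suc N. scaleC_dual (c n) (f n) |c. \<forall>n<Suc N. norm (c n) \<le> 1}"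
    thus "x \<in> {x + y |x y. x \<in> {\<Sum>n<N. scaleC_dual (c n) (f n) |c. \<forall>n<N. norm (c n) \<le> 1}
        \<and> y \<in> (\<lambda>c. scaleC_dual c (f N)) ` cball 0 1}"
      by fastforce
  qed
qed

text \<open>
  An operator on \<open>\<ell>\<^sup>1\<close> is small on all tails \<open>a - truncate_ell1 N a\<close> of elements of the unit ball as
  soon as it is small on the monomials \<open>t\<^sup>n\<close> with \<open>n \<ge> N\<close>, so truncation approximates it uniformly
  on the ball; and the truncations of the ball have image in a compact set.
\<close>

lemma compact_map_if_null_on_powers:
  fixes D :: "ell1 \<Rightarrow> (ell1 \<Rightarrow>\<^sub>L complex)"
  assumes D: "bounded_linear D" and hom: "\<And>c a. D (c *\<^sub>C a) = scaleC_dual c (D a)"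
    and null: "(\<lambda>n. D (t_ell1 ^ n)) \<longlonglongrightarrow> 0"
  shows "compact_map D"
  unfolding compact_map_def
proof (rule compact_closure_if_totally_bounded)
  fix e :: real assume "e > 0"
  obtain N where N: "\<And>n. n \<ge> N \<Longrightarrow> norm (D (t_ell1 ^ n)) < e"
    using LIMSEQ_D[OF null \<open>e > 0\<close>] by auto
  let ?K = "{\<Sum>n<N. scaleC_dual (c n) (D (t_ell1 ^ n)) | c. \<forall>n<N. norm (c n) \<le> 1}"
  have "\<exists>y\<in>?K. dist (D a) y \<le> e" if a: "norm a \<le> 1" for a
  proof
    have "D (truncate_ell1 N a) = (\<Sum>n<N. scaleC_dual (nth_ell1 a n) (D (t_ell1 ^ n)))"
      by (simp add: truncate_ell1_def linear_sum[OF bounded_linear.linear[OF D]] hom)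
    thus "D (truncate_ell1 N a) \<in> ?K"
      using norm_nth_le_norm[of a] a order_trans by blast
    let ?r = "a - truncate_ell1 N a"
    have "norm (D ?r) \<le> e * norm ?r"
    proof (rule norm_le_of_norm_monomials_le[OF D])
      fix n
      show "norm (D (nth_ell1 ?r n *\<^sub>C t_ell1 ^ n)) \<le> e * norm (nth_ell1 ?r n)"
      proof (cases "n < N")
        case True
        hence "nth_ell1 ?r n = 0" by (simp add: nth_ell1_diff nth_truncate_ell1)
        thus ?thesis using norm_scaleC_dual_le[of 0 "D (t_ell1 ^ n)"] by (simp add: hom)
      next
        case False
        have "norm (D (nth_ell1 ?r n *\<^sub>C t_ell1 ^ n)) \<le> norm (nth_ell1 ?r n) * norm (D (t_ell1 ^ n))"
          unfolding hom by (rule norm_scaleC_dual_le)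
        also have "\<dots> \<le> norm (nth_ell1 ?r n) * e"
          using N[of n] False by (intro mult_left_mono) auto
        finally show ?thesis by (simp add: mult.commute)
      qed
    qed (use \<open>e > 0\<close> in simp)
    also have "\<dots> \<le> e * 1"
    proof (intro mult_left_mono)
      have "norm ?r \<le> norm a"
        by (rule norm_ell1_mono) (simp add: nth_ell1_diff nth_truncate_ell1)
      thus "norm ?r \<le> 1" using a by simp
    qed (use \<open>e > 0\<close> in simp)
    finally show "dist (D a) (D (truncate_ell1 N a)) \<le> e"
      by (simp add: dist_norm linear_diff[OF bounded_linear.linear[OF D]])
  qed
  thus "\<exists>K. compact K \<and> (\<forall>x\<in>D ` cball 0 1. \<exists>y\<in>K. dist x y \<le> e)"
    by (intro exI[of _ ?K] conjI compact_sum_scaleC_dual) auto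
qed

text \<open>
  Evaluations at points of the unit ball are 1-Lipschitz functions on the dual, so pointwise
  convergence to 0 at a finite net carries over, up to the mesh, to all \<open>\<phi> k\<close> at once. The net is
  chosen among the \<open>\<phi> k\<close> themselves, since it is only there that convergence is known.
\<close>

lemma uniformly_null_if_relatively_compact:
  assumes K: "compact (closure (range \<phi>))"
    and null: "\<And>k. (\<lambda>m. blinfun_apply (\<phi> k) (x m)) \<longlonglongrightarrow> 0"
    and x: "\<And>m. norm (x m) \<le> 1" and "e > 0"
  shows "\<forall>\<^sub>F m in sequentially. \<forall>k. norm (blinfun_apply (\<phi> k) (x m)) < e"
proof -
  have "closure (range \<phi>) \<subseteq> (\<Union>k. ball (\<phi> k) (e / 2))"
  proof
    fix \<psi> assume "\<psi> \<in> closure (range \<phi>)"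
    then obtain k where "dist (\<phi> k) \<psi> < e / 2"
      using \<open>e > 0\<close> by (metis (no_types) closure_approachable half_gt_zero rangeE)
    thus "\<psi> \<in> (\<Union>k. ball (\<phi> k) (e / 2))" by auto
  qed
  then obtain F where F: "finite F" "closure (range \<phi>) \<subseteq> (\<Union>k\<in>F. ball (\<phi> k) (e / 2))"
    by (rule compactE_image[OF K, rotated]) auto
  have "\<forall>\<^sub>F m in sequentially. \<forall>k\<in>F. norm (blinfun_apply (\<phi> k) (x m)) < e / 2"
    using F(1) tendstoD[OF null, of "e / 2"] \<open>e > 0\<close>
    by (intro eventually_ball_finite) (auto simp: dist_norm)
  thus ?thesis
  proof eventually_elim
    case (elim m)
    show ?case
    proof
      fix k
      obtain j where j: "j \<in> F" "dist (\<phi> j) (\<phi> k) < e / 2"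
        using F(2) closure_subset[of "range \<phi>"] by fastforce
      have "norm (blinfun_apply (\<phi> k - \<phi> j) (x m)) \<le> norm (\<phi> k - \<phi> j) * norm (x m)"
        by (rule norm_blinfun)
      also have "\<dots> \<le> norm (\<phi> k - \<phi> j)"
        using x[of m] by (simp add: mult_left_le)
      also have "\<dots> < e / 2" using j(2) by (simp add: dist_norm norm_minus_commute)
      finally have "norm (blinfun_apply (\<phi> k) (x m) - blinfun_apply (\<phi> j) (x m)) < e / 2"
        by (simp add: blinfun.diff_left)
      moreover have "norm (blinfun_apply (\<phi> j) (x m)) < e / 2" using elim j(1) by blast
      ultimately show "norm (blinfun_apply (\<phi> k) (x m)) < e"
        using norm_triangle_sub[of "blinfun_apply (\<phi> k) (x m)" "blinfun_apply (\<phi> j) (x m)"]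
        by simp
    qed
  qed
qed

section \<open>Compactness of derivations\<close>

lemma derivation_power_tendsto_0:
  assumes der: "derivation D"
    and c0: "(\<lambda>n. blinfun_apply (D (t_ell1 ^ n)) 1) \<longlonglongrightarrow> 0"
  shows "(\<lambda>n. D (t_ell1 ^ n)) \<longlonglongrightarrow> 0"
proof (rule LIMSEQ_I)
  fix e :: real assume "e > 0"
  then obtain N where N: "\<And>n. n \<ge> N \<Longrightarrow> norm (blinfun_apply (D (t_ell1 ^ n)) 1) < e / 2"
    using LIMSEQ_D[OF c0, of "e / 2"] by auto
  \<comment> \<open>Taking \<open>n > N\<close> rather than \<open>n \<ge> N\<close> makes \<open>n + m\<close> positive, hence cancellable.\<close>
  have "norm (D (t_ell1 ^ n)) < e" if "n \<ge> Suc N" for n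
  proof -
    have "norm (D (t_ell1 ^ n)) \<le> e / 2"
    proof (rule norm_dual_le)
      show "D (t_ell1 ^ n) \<in> dual_ell1" using der by (simp add: derivation_def)
      fix m
      have "real (n + m) * norm (blinfun_apply (D (t_ell1 ^ n)) (t_ell1 ^ m)) \<le> real (n + m) * (e / 2)"
        unfolding norm_derivation_power_power[OF der]
        using N[of "n + m"] that \<open>e > 0\<close> by (intro mult_mono) auto
      thus "norm (blinfun_apply (D (t_ell1 ^ n)) (t_ell1 ^ m)) \<le> e / 2"
        using that by (subst (asm) mult_le_cancel_left_pos) auto
    qed
    thus ?thesis using \<open>e > 0\<close> by simp
  qed
  thus "\<exists>N. \<forall>n\<ge>N. norm (D (t_ell1 ^ n) - 0) < e" by auto
qed

lemma derivation_power_apply_power_tendsto_0: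
  assumes der: "derivation D" and D: "bounded_linear D"
  shows "(\<lambda>m. blinfun_apply (D (t_ell1 ^ n)) (t_ell1 ^ m)) \<longlonglongrightarrow> 0"
proof -
  obtain C where C: "\<And>a. norm (D a) \<le> norm a * C" using bounded_linear.bounded[OF D] by blast
  have le: "norm (blinfun_apply (D (t_ell1 ^ n)) (t_ell1 ^ m)) \<le> (real n * C) / real m"
    if "m > 0" for m
  proof -
    have "norm (blinfun_apply (D (t_ell1 ^ (n + m))) 1) \<le> C"
      using norm_apply_t_ell1_power_le[of "D (t_ell1 ^ (n + m))" 0] C[of "t_ell1 ^ (n + m)"]
      by (simp add: norm_t_ell1_power)
    hence "real (n + m) * norm (blinfun_apply (D (t_ell1 ^ n)) (t_ell1 ^ m)) \<le> real n * C"
      unfolding norm_derivation_power_power[OF der] by (intro mult_left_mono) auto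
    moreover have "real m * norm (blinfun_apply (D (t_ell1 ^ n)) (t_ell1 ^ m))
        \<le> real (n + m) * norm (blinfun_apply (D (t_ell1 ^ n)) (t_ell1 ^ m))"
      by (intro mult_right_mono) auto
    ultimately have "real m * norm (blinfun_apply (D (t_ell1 ^ n)) (t_ell1 ^ m)) \<le> real n * C"
      by linarith
    thus ?thesis using that by (simp add: field_simps)
  qed
  show ?thesis
    by (rule Lim_null_comparison[OF _ lim_const_over_n[of "real n * C"]])
       (use le in \<open>auto simp: eventually_sequentially intro!: exI[of _ 1]\<close>)
qed

text \<open>
  The value at 1 is not itself controlled by uniform decay along \<open>t\<^sup>m\<close>; the key identity moves half
  of the exponent from the argument of \<open>D\<close> to the point of evaluation, at the cost of a factor of
  at most 2.
\<close>

lemma compact_derivation_imp_null: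
  assumes der: "derivation D" and D: "bounded_linear D" and comp: "compact_map D"
  shows "(\<lambda>n. blinfun_apply (D (t_ell1 ^ n)) 1) \<longlonglongrightarrow> 0"
proof (rule LIMSEQ_I)
  fix e :: real assume "e > 0"
  have "range (\<lambda>k. D (t_ell1 ^ k)) \<subseteq> D ` cball 0 1"
    by (auto simp: norm_t_ell1_power)
  hence "compact (closure (range (\<lambda>k. D (t_ell1 ^ k))))"
    using comp unfolding compact_map_def by (metis closed_closure closure_mono compact_Int_closed inf.absorb_iff2)
  from uniformly_null_if_relatively_compact[OF this, where x = "\<lambda>m. t_ell1 ^ m" and e = "e / 2"]
  obtain M where M: "\<And>m k. m \<ge> M \<Longrightarrow> norm (blinfun_apply (D (t_ell1 ^ k)) (t_ell1 ^ m)) < e / 2"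
    using derivation_power_apply_power_tendsto_0[OF der D] \<open>e > 0\<close>
    by (auto simp: norm_t_ell1_power eventually_sequentially)
  have "norm (blinfun_apply (D (t_ell1 ^ n)) 1) < e" if n: "n \<ge> Suc (2 * M)" for n
  proof -
    \<comment> \<open>Rounding \<open>m\<close> down ensures \<open>n \<le> 2k\<close>, the source of the factor 2.\<close>
    define m where "m = n div 2"
    define k where "k = n - m"
    have mk: "n = k + m" "m \<ge> M" "k > 0" "m \<le> k"
      using n unfolding m_def k_def by auto
    have "real k * norm (blinfun_apply (D (t_ell1 ^ n)) 1)
        = real n * norm (blinfun_apply (D (t_ell1 ^ k)) (t_ell1 ^ m))"
      using norm_derivation_power_power[OF der, of k m t_ell1] mk(1) by simp
    also have "\<dots> \<le> (2 * real k) * norm (blinfun_apply (D (t_ell1 ^ k)) (t_ell1 ^ m))"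
      using mk by (intro mult_right_mono) auto
    also have "\<dots> < real k * e"
      using M[OF mk(2), of k] mk(3) by simp
    finally show ?thesis using mk(3) by simp
  qed
  thus "\<exists>N. \<forall>n\<ge>N. norm (blinfun_apply (D (t_ell1 ^ n)) 1 - 0) < e" by auto
qed

theorem theorem2p6:
  fixes D :: "ell1 \<Rightarrow> (ell1 \<Rightarrow>\<^sub>L complex)"
  assumes "derivation D" and "bounded_linear D"
  shows "compact_map D \<longleftrightarrow> (\<lambda>n. blinfun_apply (D (t_ell1 ^ Suc n)) 1) \<in> c0"
proof -
  have "(\<lambda>n. blinfun_apply (D (t_ell1 ^ Suc n)) 1) \<in> c0
      \<longleftrightarrow> (\<lambda>n. blinfun_apply (D (t_ell1 ^ n)) 1) \<longlonglongrightarrow> 0"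
    unfolding c0_def mem_Collect_eq by (rule filterlim_sequentially_Suc)
  moreover have "D (c *\<^sub>C a) = scaleC_dual c (D a)" for c a
    using assms(1) by (simp add: derivation_def)
  ultimately show ?thesis
    using compact_derivation_imp_null[OF assms]
      compact_map_if_null_on_powers[OF assms(2)] derivation_power_tendsto_0[OF assms(1)]
    by blast
qed

end
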